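(* Let $(n_i)_{i\ge 1}$ be an arithmetic sequence of positive integers, i.e. $n_i = a + (i-1)b$ for some integers $a\ge 1$, $b\ge 0$. Then $(n_i)$ is semicomplete if and only if it is one of the three sequences $\{1,3,5,7,9,\ldots\}$ (i.e. $n_i=2i-1$), $\{2,3,4,5,6,\ldots\}$ (i.e. $n_i=i+1$), or $\{1,2,3,4,5,\ldots\}$ (i.e. $n_i=i$).
   Context: A sequence $(n_i)_{i\ge1}$ of integers is called semicomplete if all its terms are positive, it is strictly increasing, and the following holds: for every integer $j>2$, letting $G_j=\frac{n_1}{j}+\frac{n_2}{j}+\cdots+\frac{n_j}{j}$, every positive integer $k<\lfloor G_j\rfloor$ can be written as $k=\frac{a_1}{j}+\cdots+\frac{a_m}{j}$ where $a_1,\ldots,a_m$ are distinct elements of $\{n_1,\ldots,n_j\}$ (equivalently, $kj$ is a sum of distinct terms among $n_1,\dots,n_j$). *)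

theory Defs
  imports Complex_Main
begin

text \<open>Sequences \<open>(n\<^sub>i)\<close> with \<open>i \<ge> 1\<close> are functions on the natural numbers whose value at index 0
  is ignored.\<close>

definition seq_mean :: "(nat \<Rightarrow> int) \<Rightarrow> nat \<Rightarrow> real" where
  "seq_mean n j = (\<Sum>i=1..j. real_of_int (n i) / real j)"

definition semicomplete :: "(nat \<Rightarrow> int) \<Rightarrow> bool" where
  "semicomplete n \<longleftrightarrow>
     (\<forall>i\<ge>1. n i > 0) \<and>
     strict_mono_on {1..} n \<and>
     (\<forall>j>2. \<forall>k::int. 0 < k \<and> k < \<lfloor>seq_mean n j\<rfloor> \<longrightarrow>
        (\<exists>A \<subseteq> n ` {1..j}. real_of_int k = (\<Sum>x\<in>A. real_of_int x / real j)))"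

end

theory Submission
  imports Defs
begin

text \<open>If the subset sums of a finite set of total \<open>T\<close> fill \<open>{r..T - r}\<close>, they still fill the
  corresponding range after adjoining an element \<open>x \<le> T + 1 - 2r\<close>; so for each of the three
  sequences an induction leaves only a small base case (\<open>r = 3, 2, 0\<close>). Since \<open>kj\<close> lies between
  \<open>j \<ge> 3\<close> and \<open>T - j\<close>, it is reached. Conversely, \<open>j = 3\<close>, \<open>k = 1\<close> forces
  \<open>a = 3\<close> or one of the three sequences, and \<open>a = 3\<close> is excluded by \<open>j = 3\<close>, \<open>k = 2\<close> together
  with \<open>j = 4\<close>, \<open>k = 1\<close>.\<close>

definition subset_sums :: "int set \<Rightarrow> int set" where
  "subset_sums A = sum id ` Pow A"

lemma mem_subset_sums_iff: "m \<in> subset_sums A \<longleftrightarrow> (\<exists>B \<subseteq> A. \<Sum>B = m)"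
  unfolding subset_sums_def id_def by blast

lemma subset_sums_empty: "subset_sums {} = {0}"
  by (simp add: subset_sums_def)

text \<open>Split by whether the subset uses \<open>x\<close>. Together with
  \<open>subset_sums_empty\<close> this also serves as a rewrite rule that computes the sums of
  explicit sets.\<close>

lemma subset_sums_insert:
  assumes "finite A" "x \<notin> A"
  shows "subset_sums (insert x A) = subset_sums A \<union> (+) x ` subset_sums A"
proof -
  have "sum id (insert x B) = x + sum id B" if "B \<subseteq> A" for B
    using that assms finite_subset by (subst sum.insert) auto
  then have "sum id ` insert x ` Pow A = (+) x ` sum id ` Pow A"
    unfolding image_image by (intro image_cong) auto
  then show ?thesis
    unfolding subset_sums_def Pow_insert image_Un by simp
qed

text \<open>One margin \<open>r\<close> serves both ends: for finite \<open>A\<close>,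
  complementation in \<open>A\<close> turns a sum \<open>m\<close> into
  \<open>\<Sum>A - m\<close>.\<close>

definition fills :: "int set \<Rightarrow> int \<Rightarrow> bool" where
  "fills A r \<longleftrightarrow> {r..\<Sum>A - r} \<subseteq> subset_sums A"

text \<open>Sums avoiding \<open>x\<close> fill an interval ending at \<open>\<Sum>A - r\<close>,
  and sums using \<open>x\<close> fill its translate, starting at \<open>r + x\<close>. The bound on
  \<open>x\<close> says that no integer lies strictly between the two.\<close>

lemma fills_insert:
  assumes A: "finite A" "x \<notin> A" "fills A r" and x: "x + 2 * r \<le> \<Sum>A + 1"
  shows "fills (insert x A) r"
  unfolding fills_def
proof
  fix m assume m: "m \<in> {r..\<Sum>(insert x A) - r}"
  have "\<Sum>(insert x A) = x + \<Sum>A"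
    using A by simp
  then have "m \<in> {r..\<Sum>A - r} \<or> m - x \<in> {r..\<Sum>A - r}"
    using m x by auto
  then have "m \<in> subset_sums A \<or> m - x \<in> subset_sums A"
    using A(3) unfolding fills_def by blast
  then show "m \<in> subset_sums (insert x A)"
    unfolding subset_sums_insert[OF A(1,2)] by force
qed

lemma fills_image_induct:
  fixes n :: "nat \<Rightarrow> int"
  assumes inj: "inj_on n {1..}"
    and base: "fills (n ` {1..j0}) r" and "j0 \<le> j"
    and step: "\<And>j. j0 \<le> j \<Longrightarrow> n (Suc j) + 2 * r \<le> (\<Sum>i=1..j. n i) + 1"
  shows "fills (n ` {1..j}) r"
  using \<open>j0 \<le> j\<close>
proof (induction j rule: dec_induct)
  case base
  show ?case by (fact assms(2))
next
  case (step j)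
  have "\<Sum>(n ` {1..j}) = (\<Sum>i=1..j. n i)"
    using inj by (subst sum.reindex) (auto intro: inj_on_subset)
  moreover have "n (Suc j) \<notin> n ` {1..j}"
  proof
    assume "n (Suc j) \<in> n ` {1..j}"
    then obtain i where "i \<in> {1..j}" "n (Suc j) = n i" by blast
    then show False
      using inj_onD[OF inj, of "Suc j" i] by auto
  qed
  ultimately have "fills (insert (n (Suc j)) (n ` {1..j})) r"
    using step.IH assms(4)[of j] step.hyps by (intro fills_insert) auto
  then show ?case
    by (simp add: atLeastAtMostSuc_conv)
qed

text \<open>For an integer \<open>k\<close>, lying below the floor of a real means that
  \<open>k + 1\<close> is at most that real. Clearing the denominator leaves a distance of at least
  \<open>j\<close> from \<open>k * int j\<close> up to the total.\<close>

lemma seq_mean_floor_gt_iff: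
  assumes "j > 0"
  shows "k < \<lfloor>seq_mean n j\<rfloor> \<longleftrightarrow> (k + 1) * int j \<le> (\<Sum>i=1..j. n i)"
proof -
  have "seq_mean n j = real_of_int (\<Sum>i=1..j. n i) / real j"
    unfolding seq_mean_def by (simp add: sum_divide_distrib)
  then have "k < \<lfloor>seq_mean n j\<rfloor> \<longleftrightarrow> real_of_int ((k + 1) * int j) \<le> real_of_int (\<Sum>i=1..j. n i)"
    using assms by (simp add: less_floor_iff pos_le_divide_eq)
  then show ?thesis
    by (simp only: of_int_le_iff)
qed

lemma scaled_sum_eq_iff:
  assumes "j > 0"
  shows "real_of_int k = (\<Sum>x\<in>A. real_of_int x / real j) \<longleftrightarrow> \<Sum>A = k * int j"
proof -
  have "real_of_int k = (\<Sum>x\<in>A. real_of_int x / real j) \<longleftrightarrow> real_of_int (\<Sum>A) = real_of_int (k * int j)"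
    using assms by (auto simp: field_simps simp flip: sum_divide_distrib)
  then show ?thesis
    by (simp only: of_int_eq_iff)
qed

lemma semicomplete_altdef:
  "semicomplete n \<longleftrightarrow>
     (\<forall>i\<ge>1. n i > 0) \<and> strict_mono_on {1..} n \<and>
     (\<forall>j>2. \<forall>k>0. (k + 1) * int j \<le> (\<Sum>i=1..j. n i) \<longrightarrow> (\<exists>A \<subseteq> n ` {1..j}. \<Sum>A = k * int j))"
  unfolding semicomplete_def
  by (simp add: seq_mean_floor_gt_iff scaled_sum_eq_iff conj_commute imp_conjL
      del: One_nat_def cong: conj_cong)

lemma semicomplete_if_fills:
  assumes "\<And>i. i \<ge> 1 \<Longrightarrow> n i > 0" and mono: "strict_mono_on {1..} n"
    and fills: "\<And>j. j > 2 \<Longrightarrow> fills (n ` {1..j}) r" and "r \<le> 3"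
  shows "semicomplete n"
  unfolding semicomplete_altdef
proof (intro conjI allI impI)
  fix j :: nat and k :: int
  assume j: "j > 2" and k: "k > 0" and le: "(k + 1) * int j \<le> (\<Sum>i=1..j. n i)"
  have "inj_on n {1..j}"
    using mono by (auto intro: inj_on_subset strict_mono_on_imp_inj_on)
  then have T: "\<Sum>(n ` {1..j}) = (\<Sum>i=1..j. n i)"
    by (subst sum.reindex) auto
  have "1 * int j \<le> k * int j"
    using k by (intro mult_right_mono) auto
  then have "r \<le> k * int j"
    using j \<open>r \<le> 3\<close> by linarith
  moreover have "k * int j \<le> \<Sum>(n ` {1..j}) - r"
    using T le j \<open>r \<le> 3\<close> by (simp add: algebra_simps)
  ultimately show "\<exists>A \<subseteq> n ` {1..j}. \<Sum>A = k * int j"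
    using fills[OF j] unfolding fills_def mem_subset_sums_iff[symmetric] by auto
qed (use assms in auto)

lemma semicomplete_odd:
  assumes n: "\<forall>i\<ge>1. n i = 2 * int i - 1"
  shows "semicomplete n"
proof (rule semicomplete_if_fills)
  show mono: "strict_mono_on {1..} n"
    using n by (auto intro!: strict_mono_onI)
  have total: "(\<Sum>i=1..j. n i) = int j ^ 2" for j
    by (induction j) (simp_all add: n power2_eq_square algebra_simps)
  have "{1..3} = {1, 2, 3::nat}" "{1..4} = {1, 2, 3, 4::nat}"
    by auto
  then have img: "n ` {1..3} = {1, 3, 5}" "n ` {1..4} = {1, 3, 5, 7}"
    using n by auto
  have "{3..6} = {3, 4, 5, 6::int}" "{3..13} = {3, 4, 5, 6, 7, 8, 9, 10, 11, 12, 13::int}"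
    by (simp_all add: simp_from_to)
  \<comment> \<open>The margin cannot be below 3, as 2 is not a sum. The induction cannot start at
    3, since 7 + 6 exceeds 9 + 1, so \<open>j = 3\<close> is checked separately.\<close>
  then have base: "fills (n ` {1..3}) 3" "fills (n ` {1..4}) 3"
    unfolding img by (simp_all add: fills_def subset_sums_insert subset_sums_empty)
  fix j :: nat assume j: "j > 2"
  show "fills (n ` {1..j}) 3"
  proof (cases "j = 3")
    case False
    show ?thesis
    proof (rule fills_image_induct[OF strict_mono_on_imp_inj_on[OF mono] base(2)])
      fix j :: nat assume "4 \<le> j"
      then have "4 * int j \<le> int j ^ 2"
        by (simp add: power2_eq_square)
      with \<open>4 \<le> j\<close> show "n (Suc j) + 2 * 3 \<le> (\<Sum>i=1..j. n i) + 1"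
        using n unfolding total by simp
    qed (use j False in auto)
  qed (use base in auto)
qed (use n in auto)

lemma semicomplete_from_two:
  assumes n: "\<forall>i\<ge>1. n i = int i + 1"
  shows "semicomplete n"
proof (rule semicomplete_if_fills)
  show mono: "strict_mono_on {1..} n"
    using n by (auto intro!: strict_mono_onI)
  have total: "2 * (\<Sum>i=1..j. n i) = int j * (int j + 3)" for j
    by (induction j) (simp_all add: n algebra_simps)
  have "{1..3} = {1, 2, 3::nat}"
    by auto
  then have img: "n ` {1..3} = {2, 3, 4}"
    using n by auto
  have "{2..7} = {2, 3, 4, 5, 6, 7::int}"
    by (simp add: simp_from_to)
  \<comment> \<open>Margin 2 because 1 is not a sum. Here the growth condition already holds at
    \<open>j = 3\<close>: 5 + 4 is at most 9 + 1.\<close>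
  then have base: "fills (n ` {1..3}) 2"
    unfolding img by (simp add: fills_def subset_sums_insert subset_sums_empty)
  fix j :: nat assume j: "j > 2"
  show "fills (n ` {1..j}) 2"
  proof (rule fills_image_induct[OF strict_mono_on_imp_inj_on[OF mono] base])
    fix j :: nat assume "3 \<le> j"
    then have "3 * (int j + 3) \<le> int j * (int j + 3)"
      by (intro mult_right_mono) auto
    with \<open>3 \<le> j\<close> show "n (Suc j) + 2 * 2 \<le> (\<Sum>i=1..j. n i) + 1"
      using n total[of j] by simp
  qed (use j in auto)
qed (use n in auto)

lemma semicomplete_from_one:
  assumes n: "\<forall>i\<ge>1. n i = int i"
  shows "semicomplete n"
proof (rule semicomplete_if_fills)
  show mono: "strict_mono_on {1..} n"
    using n by (auto intro!: strict_mono_onI)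
  \<comment> \<open>With margin 0 the induction step only asks that the next term
    \<open>j + 1\<close> be at most the total plus 1, so this crude bound suffices even from the
    empty set on.\<close>
  have total: "(\<Sum>i=1..j. n i) \<ge> int j" for j
    by (induction j) (use n in auto)
  show "fills (n ` {1..j}) 0" for j
  proof (rule fills_image_induct[OF strict_mono_on_imp_inj_on[OF mono]])
    show "fills (n ` {1..0}) 0"
      by (simp add: fills_def subset_sums_empty)
  qed (use n total in auto)
qed (use n in auto)

theorem theorem1:
  fixes n :: "nat \<Rightarrow> int" and a b :: int
  assumes "a \<ge> 1" and "b \<ge> 0"
    and "\<forall>i\<ge>1. n i = a + (int i - 1) * b"
  shows "semicomplete n \<longleftrightarrow>
    (\<forall>i\<ge>1. n i = 2 * int i - 1) \<or>
    (\<forall>i\<ge>1. n i = int i + 1) \<or>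
    (\<forall>i\<ge>1. n i = int i)"
proof
  assume sc: "semicomplete n"
  then have "n 1 < n 2"
    unfolding semicomplete_def by (auto elim!: strict_mono_onD)
  then have b: "b \<ge> 1"
    using assms by simp
  have sums: "k * int j \<in> subset_sums (n ` {1..j})"
    if "j > 2" "k > 0" "(k + 1) * int j \<le> (\<Sum>i=1..j. n i)" for j k
    using sc that unfolding semicomplete_altdef mem_subset_sums_iff by blast
  have Icc: "{1..3} = {1, 2, 3::nat}" "{1..4} = {1, 2, 3, 4::nat}"
    by auto
  have "n 1 = a" "n 2 = a + b" "n 3 = a + 2 * b" "n 4 = a + 3 * b"
    using assms(3) by simp_all
  then have img: "n ` {1..3} = {a, a + b, a + 2 * b}" "n ` {1..4} = {a, a + b, a + 2 * b, a + 3 * b}"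
    and total: "(\<Sum>i=1..3. n i) = 3 * a + 3 * b" "(\<Sum>i=1..4. n i) = 4 * a + 6 * b"
    unfolding Icc by simp_all
  have "3 \<in> subset_sums {a, a + b, a + 2 * b}"
    using sums[of 3 1] b assms(1) unfolding img total by simp
  \<comment> \<open>Besides \<open>a\<close> and \<open>a + b\<close>, only \<open>a + 2 * b\<close>
    and \<open>2 * a + b\<close> can equal 3, and each forces \<open>a = b = 1\<close>; every other
    nonempty sum exceeds 3.\<close>
  then have "a = 3 \<or> a + b = 3 \<or> a = 1 \<and> b = 1"
    using b assms(1) by (auto simp: subset_sums_insert subset_sums_empty)
  moreover have "a \<noteq> 3"
  proof
    assume "a = 3"
    have "6 \<in> subset_sums {a, a + b, a + 2 * b}"
      using sums[of 3 2] b assms(1) \<open>a = 3\<close> unfolding img total by simp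
    \<comment> \<open>The sum \<open>3 + b\<close> gives \<open>b = 3\<close>;
      \<open>3 + 2 * b\<close> is odd, and all sums of two or more terms exceed 6.\<close>
    then have "b = 3"
      using b \<open>a = 3\<close> by (auto simp: subset_sums_insert subset_sums_empty) presburger+
    \<comment> \<open>With \<open>a = b = 3\<close> every term is a multiple of 3, so 4 is
      unreachable.\<close>
    moreover have "4 \<in> subset_sums {a, a + b, a + 2 * b, a + 3 * b}"
      using sums[of 4 1] b assms(1) \<open>a = 3\<close> unfolding img total by simp
    ultimately show False
      using \<open>a = 3\<close> by (auto simp: subset_sums_insert subset_sums_empty)
  qed
  ultimately have "a = 1 \<and> b = 2 \<or> a = 2 \<and> b = 1 \<or> a = 1 \<and> b = 1"
    using b assms(1) by linarith
  then show "(\<forall>i\<ge>1. n i = 2 * int i - 1) \<or> (\<forall>i\<ge>1. n i = int i + 1) \<or> (\<forall>i\<ge>1. n i = int i)"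
    using assms(3) by auto
next
  assume "(\<forall>i\<ge>1. n i = 2 * int i - 1) \<or> (\<forall>i\<ge>1. n i = int i + 1) \<or> (\<forall>i\<ge>1. n i = int i)"
  then show "semicomplete n"
    using semicomplete_odd semicomplete_from_two semicomplete_from_one by blast
qed

end
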